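(* Let $T_0=\begin{pmatrix}0&2\\0&0\end{pmatrix}\in C_2(\mathbb{C}^2)$. Then the Harnack part of $T_0$ in $C_2(\mathbb{C}^2)$ is reduced to $\{T_0\}$.
   Context: $C_2(\mathbb{C}^2)$ is the set of $2\times2$ complex matrices $T$ whose numerical radius $w(T)=\sup\{|\langle Tx,x\rangle|:\|x\|=1\}$ is at most $1$. For $T\in C_2(\mathbb{C}^2)$ and $z$ in the open unit disc $\mathbb{D}$, put $K_z^2(T)=(I-\overline{z}T)^{-1}+(I-zT^* )^{-1}$. For $T_0,T_1\in C_2(\mathbb{C}^2)$, $T_1$ is Harnack dominated by $T_0$ if there is a constant $c\ge 1$ with $K_z^2(T_1)\le c^2K_z^2(T_0)$ for all $z\in\mathbb{D}$; they are Harnack equivalent if each is Harnack dominated by the other. The Harnack part of $T$ is its equivalence class under Harnack equivalence. *)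

theory Defs
  imports "HOL-Analysis.Analysis"
begin

text \<open>The library inner product on \<^typ>\<open>complex^'n\<close> is the real one (the real part of the
  Hermitian one), so the Hermitian inner product, linear in the first argument, is introduced here.
  Its induced norm is the library norm on \<^typ>\<open>complex^'n\<close>.\<close>

definition cinner :: "complex^'n \<Rightarrow> complex^'n \<Rightarrow> complex" where
  "cinner x y = (\<Sum>i\<in>UNIV. x $ i * cnj (y $ i))"

definition cadjoint :: "complex^'n^'n \<Rightarrow> complex^'n^'n" where
  "cadjoint A = map_matrix cnj (transpose A)"

definition numerical_radius :: "complex^'n^'n \<Rightarrow> real" where
  "numerical_radius T = Sup {cmod (cinner (T *v x) x) | x. norm x = 1}"

definition C2 :: "(complex^'n^'n) set" where
  "C2 = {T. numerical_radius T \<le> 1}"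

text \<open>For \<^prop>\<open>T \<in> C2\<close> the spectral radius of \<^term>\<open>T\<close> is at most 1, so for \<^prop>\<open>cmod z < 1\<close> both
  matrices inverted below are invertible and \<^const>\<open>matrix_inv\<close> is the genuine inverse.\<close>

definition K2 :: "complex \<Rightarrow> complex^'n^'n \<Rightarrow> complex^'n^'n" where
  "K2 z T = matrix_inv (mat 1 - map_matrix ((*) (cnj z)) T)
          + matrix_inv (mat 1 - map_matrix ((*) z) (cadjoint T))"

text \<open>The Loewner order: the difference is positive semidefinite. Membership in the nonnegative
  reals forces the quadratic form to be real, so the difference is Hermitian.\<close>

definition loewner_le :: "complex^'n^'n \<Rightarrow> complex^'n^'n \<Rightarrow> bool" where
  "loewner_le A B \<longleftrightarrow> (\<forall>x. cinner ((B - A) *v x) x \<in> \<real>\<^sub>\<ge>\<^sub>0)"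

definition harnack_dominated :: "complex^'n^'n \<Rightarrow> complex^'n^'n \<Rightarrow> bool" where
  "harnack_dominated T1 T0 \<longleftrightarrow>
     (\<exists>c::real. c \<ge> 1 \<and> (\<forall>z\<in>ball 0 1. loewner_le (K2 z T1) (c\<^sup>2 *\<^sub>R K2 z T0)))"

definition harnack_equivalent :: "complex^'n^'n \<Rightarrow> complex^'n^'n \<Rightarrow> bool" where
  "harnack_equivalent T1 T0 \<longleftrightarrow> harnack_dominated T1 T0 \<and> harnack_dominated T0 T1"

definition harnack_part :: "complex^'n^'n \<Rightarrow> (complex^'n^'n) set" where
  "harnack_part T = {S \<in> C2. harnack_equivalent S T}"

end

theory Submission
  imports Defs "HOL-Computational_Algebra.Polynomial"
begin

text \<open>By Cramer's rule, \<open>\<bar>det (I - cnj z T)\<bar>\<^sup>2 K\<^sub>z(T)\<close> is a matrix of polynomials in \<open>z\<close> and \<open>cnj z\<close>,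
  so its positivity and its domination by a multiple of \<open>K\<^sub>z(T\<^sub>0)\<close> pass from the open disc to the
  unit circle, without any information on eigenvalues of \<open>T\<close> there. On the circle
  \<open>K\<^sub>z(T\<^sub>0)\<close> has the kernel vector \<open>(1, -z)\<close>, which is therefore also annihilated by that
  polynomial matrix. The first component of this relation is a Laurent polynomial in \<open>z\<close> vanishing on
  the circle, and its coefficients force \<open>T = T\<^sub>0\<close>.\<close>

section \<open>Cramer's rule and clearing of denominators\<close>

definition adj2 :: "complex^2^2 \<Rightarrow> complex^2^2" where
  "adj2 A = vector [vector [A$2$2, - A$1$2], vector [- A$2$1, A$1$1]]"

lemma adj2_nth:
  "adj2 A $ 1 $ 1 = A$2$2" "adj2 A $ 1 $ 2 = - A$1$2"
  "adj2 A $ 2 $ 1 = - A$2$1" "adj2 A $ 2 $ 2 = A$1$1"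
  by (simp_all add: adj2_def)

lemma matrix_inv_unique:
  fixes A B :: "'a::field^'n^'n"
  assumes "A ** B = mat 1"
  shows "matrix_inv A = B"
proof -
  have BA: "B ** A = mat 1"
    using assms by (simp add: matrix_left_right_inverse)
  have "invertible A"
    unfolding invertible_def using assms BA by blast
  hence "matrix_inv A ** A = mat 1"
    unfolding invertible_def matrix_inv_def by (rule someI_ex[THEN conjunct2])
  hence "matrix_inv A ** (A ** B) = B"
    by (simp add: matrix_mul_assoc)
  thus ?thesis
    by (simp add: assms)
qed

lemma matrix_inv_2_nth:
  assumes "det A \<noteq> 0"
  shows "matrix_inv A $ i $ j = adj2 A $ i $ j / det A"
proof -
  \<comment> \<open>The determinant becomes an opaque symbol: \<open>field_simps\<close> then clears
    it as a nonzero denominator, and the product of the diagonal entries is rewritten through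
    it.\<close>
  define D where "D = det A"
  have "D \<noteq> 0" "A$1$1 * A$2$2 = D + A$1$2 * A$2$1"
    using assms by (simp_all add: D_def det_2)
  hence "A ** (\<chi> i j. adj2 A $ i $ j / det A) = mat 1"
    unfolding D_def[symmetric]
    by (simp add: vec_eq_iff forall_2 matrix_matrix_mult_def sum_2 mat_def adj2_nth field_simps)
  thus ?thesis
    by (simp add: matrix_inv_unique)
qed

abbreviation pencil :: "complex \<Rightarrow> complex^'n^'n \<Rightarrow> complex^'n^'n" where
  "pencil z T \<equiv> mat 1 - map_matrix ((*) z) T"

text \<open>Since the determinant of I - zT* is the conjugate of that of I - cnj(z)T, this is the
  sum of the two inverses multiplied by the squared modulus of the common determinant. No division
  remains, so it keeps its meaning where that determinant vanishes.\<close>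

definition cleared_K2 :: "complex \<Rightarrow> complex^2^2 \<Rightarrow> complex^2^2" where
  "cleared_K2 z T = (\<chi> i j. cnj (det (pencil (cnj z) T)) * adj2 (pencil (cnj z) T) $ i $ j
                          + det (pencil (cnj z) T) * adj2 (pencil z (cadjoint T)) $ i $ j)"

lemma cleared_K2_nth:
  assumes "det (pencil (cnj z) T) \<noteq> 0"
  shows "cleared_K2 z T $ i $ j = of_real ((cmod (det (pencil (cnj z) T)))\<^sup>2) * K2 z T $ i $ j"
proof -
  let ?D = "det (pencil (cnj z) T)"
  have D: "det (pencil z (cadjoint T)) = cnj ?D"
    by (simp add: det_2 cadjoint_def map_matrix_def transpose_def mat_def)
  have "det (pencil z (cadjoint T)) \<noteq> 0"
    using assms D by simp
  note inv = matrix_inv_2_nth[OF assms] matrix_inv_2_nth[OF this]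
  have sq: "of_real ((cmod ?D)\<^sup>2) = ?D * cnj ?D"
    by (rule complex_norm_square)
  show ?thesis
    unfolding cleared_K2_def K2_def sq using assms
    by (simp add: inv D algebra_simps)
qed

lemma cinner_mat_2:
  fixes M :: "complex^2^2"
  shows "cinner (M *v x) y = (M$1$1 * x$1 + M$1$2 * x$2) * cnj (y$1)
                           + (M$2$1 * x$1 + M$2$2 * x$2) * cnj (y$2)"
  by (simp add: cinner_def sum_2 matrix_vector_mult_def)

lemma cinner_cleared_K2:
  assumes "det (pencil (cnj z) T) \<noteq> 0"
  shows "cinner (cleared_K2 z T *v x) x
       = of_real ((cmod (det (pencil (cnj z) T)))\<^sup>2) * cinner (K2 z T *v x) x"
  unfolding cinner_mat_2 cleared_K2_nth[OF assms] by (simp add: algebra_simps)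

section \<open>Numerical radius and invertibility inside the disc\<close>

lemma cinner_self: "cinner x x = of_real ((norm x)\<^sup>2)"
  unfolding cinner_def norm_vec_def L2_set_def
  by (simp add: sum_nonneg complex_norm_square flip: of_real_power)

text \<open>A real \<open>Sup\<close> bounds its set only if the set is bounded above; here this
  comes from compactness of the unit sphere.\<close>

lemma cmod_cinner_le_numerical_radius:
  assumes "norm x = 1"
  shows "cmod (cinner (T *v x) x) \<le> numerical_radius T"
proof -
  let ?f = "\<lambda>x. cmod (cinner (T *v x) x)"
  have "continuous_on (sphere 0 1) ?f"
    unfolding cinner_def matrix_vector_mult_def by (intro continuous_intros)
  hence "compact (?f ` sphere 0 1)"
    by (intro compact_continuous_image compact_sphere)
  moreover have "{?f x | x. norm x = 1} = ?f ` sphere 0 1"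
    by auto
  ultimately have "bdd_above {?f x | x. norm x = 1}"
    by (simp add: compact_imp_bounded bounded_imp_bdd_above)
  thus ?thesis
    unfolding numerical_radius_def using assms by (intro cSup_upper) auto
qed

text \<open>A unit vector x in the kernel satisfies zTx = x, hence z<Tx,x> = 1, which is impossible
  when |z| < 1 and |<Tx,x>| \<le> 1.\<close>

lemma det_pencil_nonzero:
  assumes "T \<in> C2" and "cmod z < 1"
  shows "det (pencil z T) \<noteq> 0"
proof
  assume "det (pencil z T) = 0"
  hence "\<not> invertible (pencil z T)"
    by (simp add: invertible_det_nz)
  then obtain v where v: "v \<noteq> 0" "pencil z T *v v = 0"
    using matrix_left_invertible_ker invertible_left_inverse by metis
  define x where "x = (1 / norm v) *\<^sub>R v"
  have x: "norm x = 1"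
    using v by (simp add: x_def)
  have "pencil z T *v x = 0"
    using v(2) by (simp add: x_def vec_eq_iff matrix_vector_mult_def flip: scaleR_sum_right)
  moreover have "map_matrix ((*) z) T *v x = z *s (T *v x)"
    by (simp add: vec_eq_iff matrix_vector_mult_def map_matrix_def sum_distrib_left mult.assoc)
  ultimately have "z *s (T *v x) = x"
    by (simp add: matrix_vector_mult_diff_rdistrib)
  hence "cinner x x = z * cinner (T *v x) x"
    by (metis (no_types, lifting) cinner_def mult.assoc sum.cong sum_distrib_left vector_smult_component)
  hence "cmod z * cmod (cinner (T *v x) x) = 1"
    using x by (metis cinner_self norm_mult norm_of_real abs_one power_one)
  moreover have "cmod (cinner (T *v x) x) \<le> 1"
    using cmod_cinner_le_numerical_radius[OF x, of T] assms(1) by (simp add: C2_def)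
  ultimately show False
    using assms(2) by (metis mult_left_le norm_ge_zero not_less)
qed

text \<open>Completing the square exhibits positivity in the open disc and, for |z| = 1, the null
  vector (1, -z).\<close>

lemma cinner_cleared_K2_nilpotent:
  fixes T0 :: "complex^2^2"
  assumes "T0 = vector [vector [0, 2], vector [0, 0]]"
  shows "cinner (cleared_K2 z T0 *v x) x
       = of_real (2 * ((cmod (x$2 + z * x$1))\<^sup>2 + (1 - (cmod z)\<^sup>2) * (cmod (x$1))\<^sup>2))"
  unfolding of_real_mult of_real_add of_real_diff complex_norm_square cinner_mat_2
  by (simp add: assms cleared_K2_def adj2_nth det_2 cadjoint_def map_matrix_def transpose_def
      mat_def algebra_simps)

section \<open>Null vectors of positive semidefinite forms\<close>

lemma cinner_add_left: "cinner (x + y) z = cinner x z + cinner y z"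
  by (simp add: cinner_def distrib_right sum.distrib)

lemma cinner_add_right: "cinner x (y + z) = cinner x y + cinner x z"
  by (simp add: cinner_def distrib_left sum.distrib)

lemma cinner_smult_left: "cinner (c *s x) y = c * cinner x y"
  by (simp add: cinner_def sum_distrib_left mult.assoc)

lemma cinner_smult_right: "cinner x (c *s y) = cnj c * cinner x y"
  by (simp add: cinner_def sum_distrib_left ac_simps)

text \<open>The form is tested on x + cu with u = Mx. Its linear part in c involves <Mx,u> = |u|^2,
  so a nonzero u would make the form negative for a suitable c.\<close>

lemma psd_kernel:
  fixes M :: "complex^'n^'n"
  assumes psd: "\<And>x. cinner (M *v x) x \<in> \<real>\<^sub>\<ge>\<^sub>0" and "cinner (M *v x) x = 0"
  shows "M *v x = 0"
proof -
  define u where "u = M *v x"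
  define \<beta> where "\<beta> = cinner (M *v u) x"
  define q where "q = Re (cinner (M *v u) u)"
  define N where "N = (norm u)\<^sup>2"
  have xu: "cinner (M *v x) u = of_real N"
    by (simp add: u_def[symmetric] cinner_self N_def)
  have expand: "cinner (M *v (x + c *s u)) (x + c *s u)
      = cnj c * N + c * \<beta> + c * cnj c * cinner (M *v u) u" for c
    unfolding matrix_vector_right_distrib vector_scalar_commute cinner_add_left cinner_add_right
      cinner_smult_left cinner_smult_right xu \<beta>_def[symmetric]
    by (simp add: assms(2) algebra_simps)
  have uu: "Im (cinner (M *v u) u) = 0"
    using psd[of u] by (simp add: complex_nonneg_Reals_iff)
  \<comment> \<open>Hermitian symmetry is extracted from realness of the form: c = 1 gives the
    imaginary part of \<open>\<beta>\<close>, and c = \<i> gives the real part.\<close>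
  have "Im \<beta> = 0"
    using psd[of "x + 1 *s u"] uu unfolding expand by (simp add: complex_nonneg_Reals_iff)
  moreover have "Re \<beta> = N"
    using psd[of "x + \<i> *s u"] uu unfolding expand by (simp add: complex_nonneg_Reals_iff)
  ultimately have \<beta>: "\<beta> = of_real N"
    by (simp add: complex_eq_iff)
  have ineq: "2 * (N * t) \<le> t\<^sup>2 * q" for t :: real
    using psd[of "x + of_real (- t) *s u"] unfolding expand \<beta>
    by (simp add: complex_nonneg_Reals_iff q_def power2_eq_square)
  have "q \<ge> 0"
    using psd[of u] by (simp add: q_def complex_nonneg_Reals_iff)
  have "N \<le> 0"
  proof (cases "q = 0")
    case True
    thus ?thesis using ineq[of 1] by simp
  next
    case False
    \<comment> \<open>The value t = N / q minimises t^2 q - 2Nt.\<close>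
    have "2 * (N\<^sup>2 / q) \<le> N\<^sup>2 / q"
      using ineq[of "N / q"] False by (simp add: power2_eq_square)
    hence "N\<^sup>2 / q \<le> 0"
      by simp
    thus ?thesis
      using \<open>q \<ge> 0\<close> False by (simp add: divide_le_0_iff zero_le_divide_iff)
  qed
  thus ?thesis
    by (simp add: N_def u_def)
qed

section \<open>Passage to the unit circle\<close>

lemma continuous_cinner_cleared_K2:
  "continuous_on UNIV (\<lambda>z. cinner (cleared_K2 z T *v x) x)"
  unfolding cinner_mat_2
  by (simp add: cleared_K2_def adj2_nth det_2 cadjoint_def map_matrix_def transpose_def
      mat_def; intro continuous_intros)

text \<open>The nonnegative reals are closed, and the closed disc is the closure of the open
  one.\<close>

lemma nonneg_Reals_cball:
  fixes f :: "complex \<Rightarrow> complex"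
  assumes "continuous_on UNIV f" and "\<And>z. cmod z < 1 \<Longrightarrow> f z \<in> \<real>\<^sub>\<ge>\<^sub>0" and "cmod z \<le> 1"
  shows "f z \<in> \<real>\<^sub>\<ge>\<^sub>0"
proof -
  have "f ` closure (ball 0 1) \<subseteq> \<real>\<^sub>\<ge>\<^sub>0"
    using assms by (intro image_closure_subset) (auto intro: continuous_on_subset)
  thus ?thesis
    using assms(3) by auto
qed

lemma infinite_unit_circle: "infinite {z::complex. cmod z = 1}"
proof
  assume "finite {z::complex. cmod z = 1}"
  hence "finite (Re ` {z. cmod z = 1})"
    by simp
  moreover have "{0..1} \<subseteq> Re ` {z. cmod z = 1}"
  proof
    fix t :: real
    assume "t \<in> {0..1}"
    hence "cmod (Complex t (sqrt (1 - t\<^sup>2))) = 1"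
      by (simp add: cmod_def power_le_one)
    thus "t \<in> Re ` {z. cmod z = 1}"
      by (intro image_eqI[of _ _ "Complex t (sqrt (1 - t\<^sup>2))"]) auto
  qed
  ultimately have "finite {0..1::real}"
    by (rule rev_finite_subset)
  thus False
    by (simp add: infinite_Icc)
qed

text \<open>The form of \<open>cleared_K2 z T\<close> at (1, -z) is squeezed between 0 and a
  multiple of the form for \<open>T0\<close>, which vanishes there. One domination gives the upper
  bound, the other the positivity.\<close>

lemma harnack_equivalent_kernel:
  fixes T T0 :: "complex^2^2"
  assumes T0: "T0 = vector [vector [0, 2], vector [0, 0]]" and "T0 \<in> C2" and "T \<in> C2"
    and equiv: "harnack_equivalent T T0" and z: "cmod z = 1"
  shows "cleared_K2 z T *v vector [1, - z] = 0"
proof -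
  obtain c where c: "\<And>z. cmod z < 1 \<Longrightarrow> loewner_le (K2 z T) (c\<^sup>2 *\<^sub>R K2 z T0)"
    using equiv unfolding harnack_equivalent_def harnack_dominated_def by (metis mem_ball_0)
  obtain d where d: "d \<ge> 1" "\<And>z. cmod z < 1 \<Longrightarrow> loewner_le (K2 z T0) (d\<^sup>2 *\<^sub>R K2 z T)"
    using equiv unfolding harnack_equivalent_def harnack_dominated_def by (metis mem_ball_0)
  let ?k = "\<lambda>T z x. cinner (K2 z T *v x) x"
  let ?p = "\<lambda>T z x. cinner (cleared_K2 z T *v x) x"
  let ?D = "\<lambda>z. det (pencil (cnj z) T)"
  have form: "cinner ((r *\<^sub>R A - B) *v x) x = of_real r * cinner (A *v x) x - cinner (B *v x) x"
    for r and A B :: "complex^2^2" and x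
    unfolding cinner_mat_2 by (simp add: scaleR_conv_of_real[where 'a=complex] algebra_simps)
  \<comment> \<open>The nilpotent \<open>T0\<close> has a pencil of determinant 1, so clearing
    denominators changes nothing.\<close>
  have p0: "?p T0 z x = ?k T0 z x" for z x
  proof -
    have "det (pencil (cnj z) T0) = 1"
      by (simp add: T0 det_2 map_matrix_def mat_def)
    thus ?thesis
      by (simp add: cinner_cleared_K2)
  qed
  have p: "?p T z x = of_real ((cmod (?D z))\<^sup>2) * ?k T z x" if "cmod z < 1" for z x
    using det_pencil_nonzero[OF \<open>T \<in> C2\<close>, of "cnj z"] that by (intro cinner_cleared_K2) simp
  have k0_nonneg: "?k T0 z x \<in> \<real>\<^sub>\<ge>\<^sub>0" if "cmod z < 1" for z x
    using that unfolding p0[symmetric] cinner_cleared_K2_nilpotent[OF T0] nonneg_Reals_of_real_iff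
    by (simp add: abs_square_le_1)
  \<comment> \<open>Positivity is inherited from \<open>T0\<close>: the form of \<open>T\<close>,
    times d^2, dominates that of \<open>T0\<close>.\<close>
  have k_nonneg: "?k T z x \<in> \<real>\<^sub>\<ge>\<^sub>0" if "cmod z < 1" for z x
  proof -
    have "of_real (d\<^sup>2) * ?k T z x - ?k T0 z x \<in> \<real>\<^sub>\<ge>\<^sub>0"
      using d(2)[OF that] unfolding loewner_le_def form by blast
    hence "(of_real (d\<^sup>2) * ?k T z x - ?k T0 z x) + ?k T0 z x \<in> \<real>\<^sub>\<ge>\<^sub>0"
      using k0_nonneg[OF that] by (rule nonneg_Reals_add_I)
    hence "of_real (d\<^sup>2) * ?k T z x \<in> \<real>\<^sub>\<ge>\<^sub>0"
      by simp
    thus ?thesis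
      using d(1) by (simp add: complex_nonneg_Reals_iff zero_le_mult_iff flip: of_real_power)
  qed
  \<comment> \<open>Multiplying by the squared determinant leaves only expressions continuous on the
    whole plane, so the bound survives on the circle.\<close>
  have upper: "of_real ((cmod (?D z))\<^sup>2) * (of_real (c\<^sup>2) * ?p T0 z x) - ?p T z x \<in> \<real>\<^sub>\<ge>\<^sub>0"
    if "cmod z < 1" for z x
  proof -
    have "of_real ((cmod (?D z))\<^sup>2) * (of_real (c\<^sup>2) * ?k T0 z x - ?k T z x) \<in> \<real>\<^sub>\<ge>\<^sub>0"
      using c[OF that] unfolding loewner_le_def form
      by (intro nonneg_Reals_mult_I) auto
    thus ?thesis
      unfolding p0 p[OF that] by (simp add: algebra_simps)
  qed
  have psd: "?p T z x \<in> \<real>\<^sub>\<ge>\<^sub>0" for x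
  proof (rule nonneg_Reals_cball[OF continuous_cinner_cleared_K2])
    show "?p T z x \<in> \<real>\<^sub>\<ge>\<^sub>0" if "cmod z < 1" for z
      unfolding p[OF that] using k_nonneg[OF that] by (intro nonneg_Reals_mult_I) auto
  qed (use z in simp)
  have D: "continuous_on UNIV ?D"
    by (simp add: det_2 map_matrix_def mat_def) (intro continuous_intros)
  have "of_real ((cmod (?D z))\<^sup>2) * (of_real (c\<^sup>2) * ?p T0 z x) - ?p T z x \<in> \<real>\<^sub>\<ge>\<^sub>0" for x
    by (rule nonneg_Reals_cball[where f = "\<lambda>z. of_real ((cmod (?D z))\<^sup>2)
          * (of_real (c\<^sup>2) * ?p T0 z x) - ?p T z x"])
      (use z upper in \<open>auto intro!: continuous_intros D continuous_cinner_cleared_K2\<close>)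
  from this[of "vector [1, - z]"] have "- ?p T z (vector [1, - z]) \<in> \<real>\<^sub>\<ge>\<^sub>0"
    unfolding cinner_cleared_K2_nilpotent[OF T0] using z by simp
  with psd[of "vector [1, - z]"] have "?p T z (vector [1, - z]) = 0"
    by (auto simp: complex_nonneg_Reals_iff complex_eq_iff)
  with psd show ?thesis
    by (rule psd_kernel)
qed

section \<open>Recovery of the matrix from the kernel relation\<close>

lemma cleared_K2_kernel_imp:
  fixes T :: "complex^2^2"
  assumes "\<And>z. cmod z = 1 \<Longrightarrow> cleared_K2 z T *v vector [1, - z] = 0"
  shows "T = vector [vector [0, 2], vector [0, 0]]"
proof -
  define a b c d where "a = T$1$1" and "b = T$1$2" and "c = T$2$1" and "d = T$2$2"
  define t \<delta> where "t = a + d" and "\<delta> = a * d - b * c"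
  \<comment> \<open>This is z^2 times the first component of the kernel relation, with z * cnj z
    replaced by 1; \<open>t\<close> and \<open>\<delta>\<close> are the trace and determinant of
    \<open>T\<close>. An infinite zero set forces every coefficient to vanish.\<close>
  define p where "p = [: \<delta>, - d - t - \<delta> * cnj d, 2 - b + d * cnj t + t * cnj d - \<delta> * cnj c,
    - cnj t * (1 - b) - d * cnj \<delta> - cnj d + t * cnj c, cnj \<delta> * (1 - b) - cnj c :]"
  have "poly p z = 0" if "cmod z = 1" for z
  proof -
    have zz: "z * cnj z = 1"
      using that complex_norm_square[of z] by simp
    have D: "det (pencil (cnj z) T) = 1 - t * cnj z + \<delta> * (cnj z)\<^sup>2"
      by (simp add: det_2 map_matrix_def mat_def a_def b_def c_def d_def t_def \<delta>_def
          algebra_simps power2_eq_square)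
    have "(cleared_K2 z T *v vector [1, - z]) $ 1 = 0"
      using assms[OF that] by simp
    hence "(1 - cnj t * z + cnj \<delta> * z\<^sup>2) * (1 - d * cnj z - b * (z * cnj z))
       + (1 - t * cnj z + \<delta> * (cnj z)\<^sup>2) * (1 - cnj d * z - cnj c * z\<^sup>2) = 0"
      unfolding cleared_K2_def matrix_vector_mult_def D
      by (simp add: sum_2 adj2_nth cadjoint_def map_matrix_def transpose_def mat_def
          flip: b_def c_def d_def) (simp add: algebra_simps power2_eq_square)
    with zz show ?thesis
      unfolding p_def by simp algebra
  qed
  hence "{z. cmod z = 1} \<subseteq> {z. poly p z = 0}"
    by blast
  hence "infinite {z. poly p z = 0}"
    using infinite_unit_circle infinite_super by blast
  hence "p = 0"
    using poly_roots_finite by blast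
  hence *: "\<delta> = 0" "c = 0" "- d - t = 0" "2 - b + d * cnj t + t * cnj d = 0"
    by (auto simp: p_def)
  \<comment> \<open>With c = 0 the determinant is ad; the coefficient -d - t fixes a, so d^2 =
    0.\<close>
  have "a * d = 0" "a = - 2 * d"
    using * by (auto simp: \<delta>_def t_def algebra_simps eq_neg_iff_add_eq_0)
  hence "a = 0" "d = 0"
    by auto
  with * have "b = 2"
    by (simp add: t_def)
  with * \<open>a = 0\<close> \<open>d = 0\<close> show ?thesis
    by (simp add: vec_eq_iff forall_2 a_def b_def c_def d_def)
qed

section \<open>Membership in the class and conclusion\<close>

lemma nilpotent_in_C2:
  fixes T0 :: "complex^2^2"
  assumes "T0 = vector [vector [0, 2], vector [0, 0]]"
  shows "T0 \<in> C2"
proof -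
  have "cmod (cinner (T0 *v x) x) \<le> 1" if "norm x = 1" for x
  proof -
    have "cmod (cinner (T0 *v x) x) = 2 * cmod (x$2) * cmod (x$1)"
      by (simp add: cinner_mat_2 assms norm_mult)
    also have "\<dots> \<le> (cmod (x$1))\<^sup>2 + (cmod (x$2))\<^sup>2"
      using sum_squares_bound[of "cmod (x$2)" "cmod (x$1)"] by simp
    also have "\<dots> = (norm x)\<^sup>2"
      by (simp add: norm_vec_def L2_set_def sum_2)
    finally show ?thesis
      using that by simp
  qed
  \<comment> \<open>A unit vector must exist for \<open>cSup_least\<close>, which requires a
    nonempty set.\<close>
  moreover have "norm (axis 1 1 :: complex^2) = 1"
    by simp
  ultimately show ?thesis
    unfolding C2_def numerical_radius_def mem_Collect_eq by (intro cSup_least) blast+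
qed

theorem theorem3p1:
  fixes T0 :: "complex^2^2"
  assumes "T0 = vector [vector [0, 2], vector [0, 0]]"
  shows "T0 \<in> C2 \<and> harnack_part T0 = {T0}"
proof -
  have "T0 \<in> C2"
    using assms by (rule nilpotent_in_C2)
  moreover have "harnack_dominated T0 T0"
    unfolding harnack_dominated_def
    by (rule exI[of _ 1]) (simp add: loewner_le_def cinner_def)
  moreover have "T = T0" if "T \<in> harnack_part T0" for T
    using cleared_K2_kernel_imp harnack_equivalent_kernel[OF assms \<open>T0 \<in> C2\<close>] that assms
    unfolding harnack_part_def by blast
  ultimately show ?thesis
    by (auto simp: harnack_part_def harnack_equivalent_def)
qed

end
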